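(* For $j=0,1$ let $a_j,b_j:\mathbb{Z}\to\mathbb{R}$ with $a_j(n)<0$ for all $n\in\mathbb{Z}$, let $J_j$ be the associated $(N-1)\times(N-1)$ Jacobi matrix, and let $\lambda_0,\lambda_1\in\mathbb{R}$. Let $u_{j,-}(\lambda_j)$ and $u_{j,+}(\lambda_j)$ be solutions of $\tau_j u=\lambda_j u$ with $u_{j,-}(\lambda_j)(0)=0$ and $u_{j,+}(\lambda_j)(N)=0$. Then \begin{align*} E_{(-\infty,\lambda_1)}(J_1)-E_{(-\infty,\lambda_0]}(J_0)&=\#_{(0,N]}(u_{0,+}(\lambda_0),u_{1,-}(\lambda_1))=\#_{(0,N]}(u_{0,-}(\lambda_0),u_{1,+}(\lambda_1)),\\ E_{(-\infty,\lambda_1)}(J_1)-E_{(-\infty,\lambda_0)}(J_0)&=\#_{[0,N]}(u_{0,+}(\lambda_0),u_{1,-}(\lambda_1))=\#_{(0,N)}(u_{0,-}(\lambda_0),u_{1,+}(\lambda_1)),\\ E_{(-\infty,\lambda_1]}(J_1)-E_{(-\infty,\lambda_0]}(J_0)&=\#_{(0,N)}(u_{0,+}(\lambda_0),u_{1,-}(\lambda_1))=\#_{[0,N]}(u_{0,-}(\lambda_0),u_{1,+}(\lambda_1)),\\ E_{(-\infty,\lambda_1]}(J_1)-E_{(-\infty,\lambda_0)}(J_0)&=\#_{[0,N)}(u_{0,+}(\lambda_0),u_{1,-}(\lambda_1))=\#_{[0,N)}(u_{0,-}(\lambda_0),u_{1,+}(\lambda_1)). \end{align*}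
   Context: Let $N\ge 2$ be an integer. For $a,b:\mathbb{Z}\to\mathbb{R}$ with $a<0$, the Jacobi matrix $J$ is the real symmetric tridiagonal $(N-1)\times(N-1)$ matrix with diagonal entries $b(1),\dots,b(N-1)$ and off-diagonal entries $J_{i,i+1}=J_{i+1,i}=a(i)$, $i=1,\dots,N-2$. The difference expression is $(\tau u)(n)=a(n)u(n+1)+a(n-1)u(n-1)+b(n)u(n)$, $n\in\mathbb{Z}$. A solution of $\tau u=zu$ ($z\in\mathbb{R}$) is a real sequence $u:\mathbb{Z}\to\mathbb{R}$, $u\not\equiv 0$, satisfying the equation for all $n\in\mathbb{Z}$. $J_j,\tau_j$ denote the objects built from $a_j,b_j$. $E_\Omega(J)$ is the number of eigenvalues of $J$ in $\Omega\subseteq\mathbb{R}$. The (modified) Wronskian of a solution $u_0$ of $\tau_0u=\lambda_0u$ and a solution $u_1$ of $\tau_1u=\lambda_1u$ is $W_n=W_n(u_0,u_1)=u_0(n)a_1(n)u_1(n+1)-u_1(n)a_0(n)u_0(n+1)$. Define - $\#_n(u_0,u_1)=1$ if $W_{n+1}u_0(n+1)u_1(n+1)>0$ and either $W_nW_{n+1}<0$ or ($W_n=0$ and $W_{n+1}\ne0$); - $\#_n(u_0,u_1)=-1$ if $W_nu_0(n+1)u_1(n+1)>0$ and either $W_nW_{n+1}<0$ or ($W_n\neq0$ and $W_{n+1}=0$); - $\#_n(u_0,u_1)=0$ otherwise. For integers $m<n$ set $\#_{[m,n]}(u_0,u_1)=\sum_{j=m}^{n-1}\#_j(u_0,u_1)$.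 Let $\epsilon_k=1$ if $W_k(u_0,u_1)=0$ and $\epsilon_k=0$ otherwise. Then $\#_{(m,n]}=\#_{[m,n]}-\epsilon_m$, $\#_{[m,n)}=\#_{[m,n]}+\epsilon_n$, and $\#_{(m,n)}=\#_{[m,n]}-\epsilon_m+\epsilon_n$ (all evaluated at $(u_0,u_1)$). *)

theory Defs
  imports Complex_Main "Jordan_Normal_Form.Char_Poly"
begin

text \<open>The matrix is indexed from \<open>0\<close>, the coefficient sequences from \<open>1\<close>: row \<open>i\<close> carries the
  diagonal entry \<open>b(i + 1)\<close>. Only \<open>a(1), \<dots>, a(N - 2)\<close> and \<open>b(1), \<dots>, b(N - 1)\<close> occur.\<close>

definition jacobi_mat :: "nat \<Rightarrow> (int \<Rightarrow> real) \<Rightarrow> (int \<Rightarrow> real) \<Rightarrow> real mat" where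
  "jacobi_mat N a b = mat (N - 1) (N - 1) (\<lambda>(i, j).
     if i = j then b (int i + 1)
     else if j = i + 1 then a (int i + 1)
     else if i = j + 1 then a (int j + 1)
     else 0)"

text \<open>Distinct eigenvalues are counted; a Jacobi matrix with nonvanishing off-diagonal entries has
  only simple eigenvalues, so this agrees with counting multiplicities. The set is finite, so
  \<open>card\<close> is meaningful.\<close>

definition num_eigenvalues :: "real set \<Rightarrow> real mat \<Rightarrow> nat" where
  "num_eigenvalues \<Omega> A = card {z \<in> \<Omega>. eigenvalue A z}"

definition tau :: "(int \<Rightarrow> real) \<Rightarrow> (int \<Rightarrow> real) \<Rightarrow> (int \<Rightarrow> real) \<Rightarrow> int \<Rightarrow> real" where
  "tau a b u n = a n * u (n + 1) + a (n - 1) * u (n - 1) + b n * u n"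

definition is_solution :: "(int \<Rightarrow> real) \<Rightarrow> (int \<Rightarrow> real) \<Rightarrow> real \<Rightarrow> (int \<Rightarrow> real) \<Rightarrow> bool" where
  "is_solution a b z u \<longleftrightarrow> (\<exists>n. u n \<noteq> 0) \<and> (\<forall>n. tau a b u n = z * u n)"

text \<open>In all of the following, \<open>a0\<close> and \<open>a1\<close> are the off-diagonal coefficients belonging to \<open>u0\<close>
  and \<open>u1\<close>; in the modified Wronskian each multiplies the shifted value of its own solution.\<close>

definition wronskian ::
  "(int \<Rightarrow> real) \<Rightarrow> (int \<Rightarrow> real) \<Rightarrow> (int \<Rightarrow> real) \<Rightarrow> (int \<Rightarrow> real) \<Rightarrow> int \<Rightarrow> real" where
  "wronskian a0 a1 u0 u1 n = u0 n * a1 n * u1 (n + 1) - u1 n * a0 n * u0 (n + 1)"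

text \<open>The conditions of the first two branches exclude each other, so their order is
  immaterial: if \<open>W n * W (n + 1) < 0\<close>, then \<open>W n\<close> and \<open>W (n + 1)\<close> have opposite signs.\<close>

definition node_weight ::
  "(int \<Rightarrow> real) \<Rightarrow> (int \<Rightarrow> real) \<Rightarrow> (int \<Rightarrow> real) \<Rightarrow> (int \<Rightarrow> real) \<Rightarrow> int \<Rightarrow> int" where
  "node_weight a0 a1 u0 u1 n =
    (let W = wronskian a0 a1 u0 u1 in
      if W (n + 1) * u0 (n + 1) * u1 (n + 1) > 0 \<and>
         (W n * W (n + 1) < 0 \<or> (W n = 0 \<and> W (n + 1) \<noteq> 0)) then 1
      else if W n * u0 (n + 1) * u1 (n + 1) > 0 \<and>
         (W n * W (n + 1) < 0 \<or> (W n \<noteq> 0 \<and> W (n + 1) = 0)) then - 1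
      else 0)"

definition wronskian_zero ::
  "(int \<Rightarrow> real) \<Rightarrow> (int \<Rightarrow> real) \<Rightarrow> (int \<Rightarrow> real) \<Rightarrow> (int \<Rightarrow> real) \<Rightarrow> int \<Rightarrow> int" where
  "wronskian_zero a0 a1 u0 u1 k = (if wronskian a0 a1 u0 u1 k = 0 then 1 else 0)"

text \<open>The suffixes \<open>cc\<close>, \<open>oc\<close>, \<open>co\<close>, \<open>oo\<close> stand for the intervals \<open>[m,n]\<close>, \<open>(m,n]\<close>, \<open>[m,n)\<close>,
  \<open>(m,n)\<close>. Opening the right end adds the correction term, opening the left end subtracts it.\<close>

definition nodes_cc ::
  "(int \<Rightarrow> real) \<Rightarrow> (int \<Rightarrow> real) \<Rightarrow> (int \<Rightarrow> real) \<Rightarrow> (int \<Rightarrow> real) \<Rightarrow> int \<Rightarrow> int \<Rightarrow> int" where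
  "nodes_cc a0 a1 u0 u1 m n = (\<Sum>j = m..n - 1. node_weight a0 a1 u0 u1 j)"

definition nodes_oc ::
  "(int \<Rightarrow> real) \<Rightarrow> (int \<Rightarrow> real) \<Rightarrow> (int \<Rightarrow> real) \<Rightarrow> (int \<Rightarrow> real) \<Rightarrow> int \<Rightarrow> int \<Rightarrow> int" where
  "nodes_oc a0 a1 u0 u1 m n = nodes_cc a0 a1 u0 u1 m n - wronskian_zero a0 a1 u0 u1 m"

definition nodes_co ::
  "(int \<Rightarrow> real) \<Rightarrow> (int \<Rightarrow> real) \<Rightarrow> (int \<Rightarrow> real) \<Rightarrow> (int \<Rightarrow> real) \<Rightarrow> int \<Rightarrow> int \<Rightarrow> int" where
  "nodes_co a0 a1 u0 u1 m n = nodes_cc a0 a1 u0 u1 m n + wronskian_zero a0 a1 u0 u1 n"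

definition nodes_oo ::
  "(int \<Rightarrow> real) \<Rightarrow> (int \<Rightarrow> real) \<Rightarrow> (int \<Rightarrow> real) \<Rightarrow> (int \<Rightarrow> real) \<Rightarrow> int \<Rightarrow> int \<Rightarrow> int" where
  "nodes_oo a0 a1 u0 u1 m n =
    nodes_cc a0 a1 u0 u1 m n - wronskian_zero a0 a1 u0 u1 m + wronskian_zero a0 a1 u0 u1 n"

end

theory Submission
  imports Defs
begin

text \<open>Attach to a solution \<open>u\<close> a lifted phase: the number of sign changes so far, followed by
  \<open>a(n) u(n+1) / u(n)\<close>. A comparison of signs shows that \<open>#_n\<close> is the increment of the rounded-up
  difference of the phases of \<open>u1\<close> and \<open>u0\<close>, so \<open>#_[0,N]\<close> telescopes to a difference of sign-change
  counts plus boundary terms. The sign changes of a solution vanishing at \<open>0\<close> count eigenvalues by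
  Sturm oscillation: as polynomials in the spectral parameter, consecutive values of the solution
  interlace because their Wronskian is a sum of squares. Solutions vanishing at \<open>N\<close> are treated by
  reflecting the matrix.\<close>

section \<open>Counting roots by sign changes\<close>

text \<open>A zero in the middle of a solution separates opposite signs, so it is charged once, to the step
  leaving it.\<close>

definition flip :: "real \<Rightarrow> real \<Rightarrow> int" where
  "flip x y = of_bool (x * y < 0) + of_bool (x = 0)"

definition flips :: "(int \<Rightarrow> real) \<Rightarrow> nat \<Rightarrow> int" where
  "flips u m = (\<Sum>j<m. flip (u (int j)) (u (int j + 1)))"

lemma flip_mult:
  assumes c: "c \<noteq> 0"
  shows "flip (c * x) (c * y) = flip x y"
proof -
  have eq: "c * x * (c * y) = c\<^sup>2 * (x * y)" by (simp add: power2_eq_square)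
  have "c\<^sup>2 * (x * y) < 0 \<longleftrightarrow> x * y < 0"
    using c by (simp add: mult_less_0_iff[of "c\<^sup>2"])
  then show ?thesis unfolding flip_def eq using c by simp
qed

text \<open>Each comparison with a point of \<open>S\<close> settles on one side of
  \<open>c\<close>, and finiteness lets all of them settle at once. Because the count is strict, it
  is left continuous and its whole jump appears to the right of \<open>c\<close>.\<close>

lemma eventually_card_less_at_left:
  fixes S :: "real set"
  assumes "finite S"
  shows "\<forall>\<^sub>F x in at_left c. card {s \<in> S. s < x} = card {s \<in> S. s < c}"
proof -
  have "\<forall>\<^sub>F x in at_left c. s < x \<longleftrightarrow> s < c" for s
  proof (cases "s < c")
    case True
    then have "\<forall>\<^sub>F x in at_left c. x \<in> {s<..<c}" by (intro eventually_at_leftI[of s c]) auto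
    then show ?thesis using True by (auto elim: eventually_mono)
  next
    case False
    have "\<forall>\<^sub>F x in at_left c. x < c" by (simp add: eventually_at_filter)
    then show ?thesis using False by (auto elim: eventually_mono)
  qed
  then have "\<forall>\<^sub>F x in at_left c. \<forall>s\<in>S. s < x \<longleftrightarrow> s < c"
    using assms by (simp add: eventually_ball_finite)
  then show ?thesis by (rule eventually_mono) (metis (mono_tags, lifting) Collect_cong)
qed

lemma eventually_card_less_at_right:
  fixes S :: "real set"
  assumes "finite S"
  shows "\<forall>\<^sub>F x in at_right c. card {s \<in> S. s < x} = card {s \<in> S. s < c} + of_bool (c \<in> S)"
proof -
  have "\<forall>\<^sub>F x in at_right c. s < x \<longleftrightarrow> s \<le> c" for s
  proof (cases "s \<le> c")
    case True
    have "\<forall>\<^sub>F x in at_right c. c < x" by (simp add: eventually_at_filter)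
    then show ?thesis using True by (auto elim: eventually_mono)
  next
    case False
    then have "\<forall>\<^sub>F x in at_right c. x \<in> {c<..<s}" by (intro eventually_at_rightI[of c s]) auto
    then show ?thesis using False by (auto elim: eventually_mono)
  qed
  then have "\<forall>\<^sub>F x in at_right c. \<forall>s\<in>S. s < x \<longleftrightarrow> s \<le> c"
    using assms by (simp add: eventually_ball_finite)
  moreover have "card {s \<in> S. s \<le> c} = card {s \<in> S. s < c} + of_bool (c \<in> S)"
  proof (cases "c \<in> S")
    case True
    then have "{s \<in> S. s \<le> c} = insert c {s \<in> S. s < c}" by auto
    then show ?thesis using True assms by simp
  next
    case False
    then have "{s \<in> S. s \<le> c} = {s \<in> S. s < c}" by (auto simp: less_le)
    then show ?thesis using False by simp
  qed
  ultimately show ?thesis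
    by (elim eventually_mono) (metis (mono_tags, lifting) Collect_cong)
qed

definition roots_below :: "real poly \<Rightarrow> real \<Rightarrow> nat" where
  "roots_below p x = card {s. s < x \<and> poly p s = 0}"

lemma roots_below_one [simp]: "roots_below 1 x = 0"
  by (simp add: roots_below_def)

text \<open>The hypothesis says that \<open>p / q\<close> is strictly decreasing: the two sides jump together at each
  root of \<open>p\<close> or \<open>q\<close>, so their difference is locally constant, and it vanishes near minus infinity.\<close>

lemma roots_below_interlacing:
  assumes W: "\<And>x. poly (pderiv p) x * poly q x - poly p x * poly (pderiv q) x < 0"
    and bot: "\<forall>\<^sub>F x in at_bot. poly p x > 0 \<and> poly q x > 0"
  shows "int (roots_below p x) = int (roots_below q x) + flip (poly q x) (poly p x)"
proof -
  define S where "S = {s. poly p s = 0}"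
  define T where "T = {s. poly q s = 0}"
  have "p \<noteq> 0" "q \<noteq> 0" using W[of 0] by auto
  then have fin: "finite S" "finite T" by (auto simp: S_def T_def poly_roots_finite)
  have rb: "roots_below p y = card {s \<in> S. s < y}" "roots_below q y = card {s \<in> T. s < y}" for y
    unfolding roots_below_def S_def T_def by (auto intro: arg_cong[where f = card])
  define h where "h y = int (roots_below p y) - int (roots_below q y) - flip (poly q y) (poly p y)" for y
  have disj: "\<not> (poly p c = 0 \<and> poly q c = 0)" for c using W[of c] by auto
  have ne: "\<forall>\<^sub>F y in at c. poly p y \<noteq> 0 \<and> poly q y \<noteq> 0" for c
  proof -
    have "finite (S \<union> T)" using fin by simp
    then have "\<forall>\<^sub>F y in at c. \<forall>s\<in>S \<union> T. y \<noteq> s"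
      by (auto intro!: eventually_ball_finite eventually_neq_at_within)
    then show ?thesis by (rule eventually_mono) (auto simp: S_def T_def)
  qed
  have loc: "\<forall>\<^sub>F y in at c. h c = h y" for c
  proof -
    have neL: "\<forall>\<^sub>F y in at_left c. poly p y \<noteq> 0 \<and> poly q y \<noteq> 0"
      and neR: "\<forall>\<^sub>F y in at_right c. poly p y \<noteq> 0 \<and> poly q y \<noteq> 0"
      using ne[of c] by (simp_all add: eventually_at_split)
    have d: "DERIV (\<lambda>y. poly q y * poly p y) c :> poly (pderiv q) c * poly p c + poly (pderiv p) c * poly q c"
      by (auto intro!: derivative_eq_intros)
    let ?g = "\<lambda>y. poly q y * poly p y"
    \<comment> \<open>The charge for a zero of \<open>q\<close> makes \<open>flip\<close> left
      continuous, like the root counts. To the right of \<open>c\<close> it gains one at a root of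
      \<open>p\<close> and loses one at a root of \<open>q\<close>, as the difference of the counts
      does.\<close>
    have sgnL: "\<forall>\<^sub>F y in at_left c. ?g y < 0 \<longleftrightarrow> flip (poly q c) (poly p c) = 1"
      and sgnR: "\<forall>\<^sub>F y in at_right c. ?g y < 0 \<longleftrightarrow>
        flip (poly q c) (poly p c) + of_bool (c \<in> S) - of_bool (c \<in> T) = 1"
    proof -
      consider (a) "?g c < 0" | (b) "?g c > 0" | (p) "poly p c = 0" | (q) "poly q c = 0"
        by (metis linorder_neqE_linordered_idom mult_eq_0_iff)
      then have "(\<forall>\<^sub>F y in at_left c. ?g y < 0 \<longleftrightarrow> flip (poly q c) (poly p c) = 1) \<and>
        (\<forall>\<^sub>F y in at_right c. ?g y < 0 \<longleftrightarrow>
          flip (poly q c) (poly p c) + of_bool (c \<in> S) - of_bool (c \<in> T) = 1)"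
      proof cases
        case a
        have "isCont ?g c" by simp
        then have "\<forall>\<^sub>F y in at c. ?g y < 0" using a by (simp add: isCont_def order_tendstoD)
        moreover have "poly p c \<noteq> 0" "poly q c \<noteq> 0" using a by auto
        ultimately show ?thesis using a
          by (auto simp: eventually_at_split flip_def S_def T_def elim!: eventually_mono)
      next
        case b
        have "isCont ?g c" by simp
        then have "\<forall>\<^sub>F y in at c. ?g y > 0" using b by (simp add: isCont_def order_tendstoD)
        moreover have "poly p c \<noteq> 0" "poly q c \<noteq> 0" using b by auto
        ultimately show ?thesis using b
          by (auto simp: eventually_at_split flip_def S_def T_def elim!: eventually_mono)
      next
        case p
        then have q0: "poly q c \<noteq> 0" using disj by auto
        \<comment> \<open>Only \<open>p' q\<close> survives in the derivative of the product, and
          \<open>W\<close> makes it negative; at a root of \<open>q\<close> the surviving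
          \<open>p q'\<close> is positive instead.\<close>
        have "poly (pderiv q) c * poly p c + poly (pderiv p) c * poly q c < 0" using W[of c] p by simp
        note dec = DERIV_neg_dec_left[OF d this] DERIV_neg_dec_right[OF d this]
        from dec(1) obtain e where e: "e > 0" "\<And>k. 0 < k \<Longrightarrow> k < e \<Longrightarrow> ?g c < ?g (c - k)" by auto
        have L: "\<forall>\<^sub>F y in at_left c. ?g y > 0"
        proof (rule eventually_at_leftI[of "c - e"])
          fix y assume "y \<in> {c - e<..<c}" then show "?g y > 0" using e(2)[of "c - y"] p by simp
        qed (use e in simp)
        from dec(2) obtain e where e: "e > 0" "\<And>k. 0 < k \<Longrightarrow> k < e \<Longrightarrow> ?g c > ?g (c + k)" by auto
        have R: "\<forall>\<^sub>F y in at_right c. ?g y < 0"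
        proof (rule eventually_at_rightI[of c "c + e"])
          fix y assume "y \<in> {c<..<c + e}" then show "?g y < 0" using e(2)[of "y - c"] p by simp
        qed (use e in simp)
        show ?thesis using L R p q0 by (auto simp: flip_def S_def T_def elim!: eventually_mono)
      next
        case q
        then have p0: "poly p c \<noteq> 0" using disj by auto
        have "poly (pderiv q) c * poly p c + poly (pderiv p) c * poly q c > 0"
          using W[of c] q by (simp add: mult.commute)
        note inc = DERIV_pos_inc_left[OF d this] DERIV_pos_inc_right[OF d this]
        from inc(1) obtain e where e: "e > 0" "\<And>k. 0 < k \<Longrightarrow> k < e \<Longrightarrow> ?g c > ?g (c - k)" by auto
        have L: "\<forall>\<^sub>F y in at_left c. ?g y < 0"
        proof (rule eventually_at_leftI[of "c - e"])
          fix y assume "y \<in> {c - e<..<c}" then show "?g y < 0" using e(2)[of "c - y"] q by simp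
        qed (use e in simp)
        from inc(2) obtain e where e: "e > 0" "\<And>k. 0 < k \<Longrightarrow> k < e \<Longrightarrow> ?g c < ?g (c + k)" by auto
        have R: "\<forall>\<^sub>F y in at_right c. ?g y > 0"
        proof (rule eventually_at_rightI[of c "c + e"])
          fix y assume "y \<in> {c<..<c + e}" then show "?g y > 0" using e(2)[of "y - c"] q by simp
        qed (use e in simp)
        show ?thesis using L R q p0 by (auto simp: flip_def S_def T_def elim!: eventually_mono)
      qed
      then show "\<forall>\<^sub>F y in at_left c. ?g y < 0 \<longleftrightarrow> flip (poly q c) (poly p c) = 1"
        "\<forall>\<^sub>F y in at_right c. ?g y < 0 \<longleftrightarrow>
          flip (poly q c) (poly p c) + of_bool (c \<in> S) - of_bool (c \<in> T) = 1" by auto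
    qed
    \<comment> \<open>The sign facts only test for the value 1; membership in \<open>{0, 1}\<close>
      turns them into equations.\<close>
    have f01: "flip (poly q c) (poly p c) \<in> {0, 1}" by (auto simp: flip_def)
    have f01': "flip (poly q c) (poly p c) + of_bool (c \<in> S) - of_bool (c \<in> T) \<in> {0, 1}"
      using disj[of c] by (auto simp: flip_def S_def T_def)
    have "\<forall>\<^sub>F y in at_left c. h c = h y"
      using eventually_card_less_at_left[OF fin(1), of c] eventually_card_less_at_left[OF fin(2), of c] neL sgnL
    proof eventually_elim
      case (elim y)
      then show ?case using f01 by (auto simp: h_def rb flip_def[of "poly q y"])
    qed
    moreover have "\<forall>\<^sub>F y in at_right c. h c = h y"
      using eventually_card_less_at_right[OF fin(1), of c] eventually_card_less_at_right[OF fin(2), of c] neR sgnR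
    proof eventually_elim
      case (elim y)
      then have "flip (poly q y) (poly p y) = flip (poly q c) (poly p c) + of_bool (c \<in> S) - of_bool (c \<in> T)"
        using f01' unfolding flip_def[of "poly q y"] by (auto simp only: of_bool_eq insert_iff empty_iff)
      then show ?case using elim by (simp add: h_def rb)
    qed
    ultimately show ?thesis by (simp add: eventually_at_split)
  qed
  obtain B where B: "\<And>y. y \<le> B \<Longrightarrow> poly p y > 0 \<and> poly q y > 0"
    using bot by (auto simp: eventually_at_bot_linorder)
  have "{s. s < B \<and> poly p s = 0} = {}" "{s. s < B \<and> poly q s = 0} = {}"
    by (auto dest!: B[OF less_imp_le])
  then have "roots_below p B = 0" "roots_below q B = 0"
    by (simp_all only: roots_below_def card.empty)
  moreover have "flip (poly q B) (poly p B) = 0"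
    using B[of B] by (auto simp: flip_def mult_less_0_iff)
  ultimately have "h B = 0" by (simp add: h_def)
  moreover have "h x = h B"
    using connected_local_const[OF connected_UNIV, of x B h] loc by auto
  ultimately show ?thesis by (simp add: h_def)
qed

section \<open>Sturm oscillation for Jacobi matrices\<close>

text \<open>As a function of \<open>z\<close>, this is the solution of \<open>\<tau> u = z u\<close> with \<open>u(0) = 0\<close> and \<open>u(1) = 1\<close>.\<close>

fun orth_poly :: "(int \<Rightarrow> real) \<Rightarrow> (int \<Rightarrow> real) \<Rightarrow> nat \<Rightarrow> real poly" where
  "orth_poly a b 0 = 0"
| "orth_poly a b (Suc 0) = 1"
| "orth_poly a b (Suc (Suc n)) = Polynomial.smult (1 / a (int n + 1))
     ([:- b (int n + 1), 1:] * orth_poly a b (Suc n) - Polynomial.smult (a (int n)) (orth_poly a b n))"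

text \<open>Confluent Christoffel-Darboux: each recurrence step adds the square of a polynomial
  value, starting from 1. As \<open>a (int n + 1)\<close> is negative, the Wronskian itself is
  negative, as interlacing demands.\<close>

lemma orth_poly_wronskian:
  assumes a: "\<And>n. a n < 0"
  shows "a (int n + 1) * (poly (pderiv (orth_poly a b (Suc (Suc n)))) x * poly (orth_poly a b (Suc n)) x
    - poly (orth_poly a b (Suc (Suc n))) x * poly (pderiv (orth_poly a b (Suc n))) x) > 0"
proof (induction n)
  case 0
  show ?case using a[of 1] by (simp add: pderiv_smult pderiv_pCons pderiv_diff pderiv_mult)
next
  case (Suc n)
  define p where "p = orth_poly a b (Suc (Suc (Suc n)))"
  define q where "q = orth_poly a b (Suc (Suc n))"
  define r where "r = orth_poly a b (Suc n)"
  have a0: "a (int n + 2) \<noteq> 0" using a[of "int n + 2"] by simp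
  \<comment> \<open>Clearing the denominator lets the value and the derivative of \<open>p\<close>
    be expressed by those of \<open>q\<close> and \<open>r\<close>.\<close>
  have eq: "Polynomial.smult (a (int n + 2)) p =
      [:- b (int n + 2), 1:] * q - Polynomial.smult (a (int n + 1)) r"
    using a0 unfolding p_def q_def r_def
    by (subst orth_poly.simps(3)[of a b "Suc n"]) (simp add: add.commute add.left_commute)
  have e1: "a (int n + 2) * poly p x = (x - b (int n + 2)) * poly q x - a (int n + 1) * poly r x"
    using arg_cong[OF eq, of "\<lambda>p. poly p x"] by (simp add: algebra_simps)
  have e2: "a (int n + 2) * poly (pderiv p) x =
      poly q x + (x - b (int n + 2)) * poly (pderiv q) x - a (int n + 1) * poly (pderiv r) x"
    using arg_cong[OF eq, of "\<lambda>p. poly (pderiv p) x"]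
    by (simp add: pderiv_smult pderiv_add pderiv_diff pderiv_mult pderiv_pCons algebra_simps)
  have "a (int (Suc n) + 1) * (poly (pderiv p) x * poly q x - poly p x * poly (pderiv q) x)
    = (a (int n + 2) * poly (pderiv p) x) * poly q x - (a (int n + 2) * poly p x) * poly (pderiv q) x"
    by (simp add: algebra_simps)
  also have "\<dots> = (poly q x)\<^sup>2 + a (int n + 1) * (poly (pderiv q) x * poly r x - poly q x * poly (pderiv r) x)"
    unfolding e1 e2 by (simp add: algebra_simps power2_eq_square)
  also have "\<dots> > 0" using Suc.IH unfolding q_def r_def by (intro add_nonneg_pos) simp_all
  finally show ?case unfolding p_def q_def .
qed

text \<open>This provides the signs near minus infinity. Positivity alone does not pass through the
  recurrence, where the older value enters with a negative coefficient; monotonicity in the index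
  bounds that term.\<close>

lemma eventually_orth_poly_pos:
  assumes a: "\<And>n. a n < 0"
  shows "\<forall>\<^sub>F x in at_bot. 0 \<le> poly (orth_poly a b n) x \<and>
    poly (orth_poly a b n) x \<le> poly (orth_poly a b (Suc n)) x \<and> 0 < poly (orth_poly a b (Suc n)) x"
proof (induction n)
  case 0
  show ?case by simp
next
  case (Suc n)
  \<comment> \<open>The threshold below which
    \<open>x - b (int n + 1) - a (int n) \<le> a (int n + 1)\<close>, which makes the new value at
    least \<open>?q\<close>.\<close>
  let ?c = "b (int n + 1) + a (int n) + a (int n + 1)"
  show ?case using Suc.IH eventually_le_at_bot[of ?c]
  proof eventually_elim
    case (elim x)
    let ?q = "poly (orth_poly a b (Suc n)) x" and ?r = "poly (orth_poly a b n) x"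
    have a1: "a (int n + 1) < 0" "a (int n) < 0" using a by auto
    have "a (int n) * ?q \<le> a (int n) * ?r" using elim a1 by (simp add: mult_left_mono_neg)
    moreover have "(x - b (int n + 1) - a (int n)) * ?q \<le> a (int n + 1) * ?q"
      using elim by (intro mult_right_mono) auto
    ultimately have "(x - b (int n + 1)) * ?q - a (int n) * ?r \<le> a (int n + 1) * ?q"
      by (simp add: algebra_simps)
    then have "?q \<le> ((x - b (int n + 1)) * ?q - a (int n) * ?r) / a (int n + 1)"
      using a1 by (simp add: neg_le_divide_eq mult.commute)
    also have "\<dots> = poly (orth_poly a b (Suc (Suc n))) x" using a1 by (simp add: field_simps)
    finally show ?case using elim by auto
  qed
qed

text \<open>Interlacing is iterated from the constant polynomial at index 1. The pair of indices 0
  and 1 has Wronskian zero, so its \<open>flip\<close> stays out of the sum.\<close>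

lemma roots_below_orth_poly:
  assumes a: "\<And>n. a n < 0"
  shows "int (roots_below (orth_poly a b (Suc n)) x) =
    (\<Sum>j<n. flip (poly (orth_poly a b (Suc j)) x) (poly (orth_poly a b (Suc (Suc j))) x))"
proof (induction n)
  case (Suc n)
  have "poly (pderiv (orth_poly a b (Suc (Suc n)))) y * poly (orth_poly a b (Suc n)) y
    - poly (orth_poly a b (Suc (Suc n))) y * poly (pderiv (orth_poly a b (Suc n))) y < 0" for y
    using orth_poly_wronskian[of a n b y, OF a] a[of "int n + 1"] by (simp only: zero_less_mult_iff) auto
  moreover have "\<forall>\<^sub>F y in at_bot. poly (orth_poly a b (Suc (Suc n))) y > 0 \<and> poly (orth_poly a b (Suc n)) y > 0"
    using eventually_orth_poly_pos[of a b "Suc n", OF a] eventually_orth_poly_pos[of a b n, OF a]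
    by eventually_elim auto
  ultimately have "int (roots_below (orth_poly a b (Suc (Suc n))) x) = int (roots_below (orth_poly a b (Suc n)) x)
      + flip (poly (orth_poly a b (Suc n)) x) (poly (orth_poly a b (Suc (Suc n))) x)"
    by (rule roots_below_interlacing)
  then show ?case unfolding Suc.IH sum.lessThan_Suc .
qed simp

text \<open>The equation is assumed only between the end points, so that eigenvectors padded by
  zeros are covered as well as solutions on all integers.\<close>

lemma orth_poly_unique:
  assumes a: "\<And>n. a n < 0" and u0: "u 0 = 0"
    and u: "\<And>n. 1 \<le> n \<Longrightarrow> n < int N \<Longrightarrow> tau a b u n = z * u n"
  shows "k \<le> N \<Longrightarrow> u (int k) = u 1 * poly (orth_poly a b k) z"
proof (induction k rule: induct_nat_012)
  case (ge2 n)
  have eq: "a (int n + 1) * u (int n + 2) = (z - b (int n + 1)) * u (int n + 1) - a (int n) * u (int n)"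
    using u[of "int n + 1"] ge2.prems by (simp add: tau_def algebra_simps)
  have a1: "a (int n + 1) \<noteq> 0" using a[of "int n + 1"] by simp
  then have "u (int n + 2) = ((z - b (int n + 1)) * u (int n + 1) - a (int n) * u (int n)) / a (int n + 1)"
    using eq by (simp add: field_simps)
  moreover have "u (int n) = u 1 * poly (orth_poly a b n) z"
    "u (int n + 1) = u 1 * poly (orth_poly a b (Suc n)) z"
    using ge2 by (simp_all add: add.commute)
  ultimately show ?case using a1 by (simp add: field_simps)
qed (use u0 in auto)

section \<open>The Dirichlet problem for the Jacobi matrix\<close>

lemma dim_jacobi_mat [simp]:
  "dim_row (jacobi_mat N a b) = N - 1" "dim_col (jacobi_mat N a b) = N - 1"
  by (simp_all add: jacobi_mat_def)

text \<open>The zeros at \<open>0\<close> and \<open>N\<close> stand in for the neighbours that the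
  first and the last row lack.\<close>

lemma jacobi_mat_mult_vec:
  assumes "u 0 = 0" "u (int N) = 0" and i: "i < N - 1"
  shows "(jacobi_mat N a b *\<^sub>v vec (N - 1) (\<lambda>j. u (int j + 1))) $ i = tau a b u (int i + 1)"
proof -
  have "(jacobi_mat N a b *\<^sub>v vec (N - 1) (\<lambda>j. u (int j + 1))) $ i =
    (\<Sum>j<N - 1. (if i = j then b (int i + 1) else if j = i + 1 then a (int i + 1)
         else if i = j + 1 then a (int j + 1) else 0) * u (int j + 1))"
    using i by (auto simp: jacobi_mat_def scalar_prod_def lessThan_atLeast0 intro!: sum.cong)
  \<comment> \<open>For \<open>i = 0\<close> the truncated \<open>i - 1\<close> is the genuine index
    \<open>0\<close>; the inner test \<open>i > 0\<close> removes this spurious term.\<close>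
  also have "\<dots> = (\<Sum>j<N - 1. (if j = i then b (int i + 1) * u (int i + 1) else 0)
      + (if j = i + 1 then a (int i + 1) * u (int i + 2) else 0)
      + (if j = i - 1 then (if i > 0 then a (int i) * u (int i) else 0) else 0))"
    by (rule sum.cong) (auto simp: algebra_simps of_nat_diff)
  also have "\<dots> = b (int i + 1) * u (int i + 1)
      + (if i + 1 < N - 1 then a (int i + 1) * u (int i + 2) else 0)
      + (if i > 0 then a (int i) * u (int i) else 0)"
    using i by (simp add: sum.distrib)
  also have "(if i + 1 < N - 1 then a (int i + 1) * u (int i + 2) else 0) = a (int i + 1) * u (int i + 2)"
  proof (cases "i + 1 < N - 1")
    case False
    then have "int i + 2 = int N" using i by linarith
    then show ?thesis using assms False by simp
  qed simp
  also have "(if i > 0 then a (int i) * u (int i) else 0) = a (int i) * u (int i)"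
    using assms by auto
  finally show ?thesis by (simp add: tau_def add.commute)
qed

text \<open>Sequences vanishing at \<open>0\<close> and \<open>N\<close> absorb the index shift of
  the matrix; this form serves both shooting from the left and reflection.\<close>

lemma eigenvalue_jacobi_mat_iff:
  "eigenvalue (jacobi_mat N a b) z \<longleftrightarrow>
    (\<exists>u. u 0 = 0 \<and> u (int N) = 0 \<and> (\<exists>n. 1 \<le> n \<and> n < int N \<and> u n \<noteq> 0) \<and>
      (\<forall>n. 1 \<le> n \<and> n < int N \<longrightarrow> tau a b u n = z * u n))" (is "?L \<longleftrightarrow> ?R")
proof
  assume ?L
  then obtain v where v: "v \<in> carrier_vec (N - 1)" "v \<noteq> 0\<^sub>v (N - 1)"
    "jacobi_mat N a b *\<^sub>v v = z \<cdot>\<^sub>v v"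
    by (auto simp: eigenvalue_def eigenvector_def)
  define u where "u n = (if 1 \<le> n \<and> n < int N then v $ (nat n - 1) else 0)" for n
  have veq: "v = vec (N - 1) (\<lambda>j. u (int j + 1))"
    using v(1) by (intro eq_vecI) (auto simp: u_def nat_add_distrib)
  have bd: "u 0 = 0" "u (int N) = 0" by (simp_all add: u_def)
  obtain i where "i < N - 1" "v $ i \<noteq> 0" using v(1,2) by (auto simp: vec_eq_iff)
  then have "1 \<le> int i + 1 \<and> int i + 1 < int N \<and> u (int i + 1) \<noteq> 0" by (auto simp: u_def nat_add_distrib)
  moreover have "tau a b u n = z * u n" if n: "1 \<le> n" "n < int N" for n
  proof -
    define i where "i = nat n - 1"
    have i: "i < N - 1" "int i + 1 = n" using n by (auto simp: i_def)
    have "tau a b u n = (jacobi_mat N a b *\<^sub>v v) $ i"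
      using jacobi_mat_mult_vec[OF bd i(1), of a b] i(2) veq by simp
    also have "\<dots> = z * v $ i" unfolding v(3) using i v(1) by simp
    also have "v $ i = u n" using n by (simp add: u_def i_def)
    finally show ?thesis .
  qed
  ultimately show ?R using bd by blast
next
  assume ?R
  then obtain u n where u: "u 0 = 0" "u (int N) = 0" "1 \<le> n" "n < int N" "u n \<noteq> 0"
    "\<And>n. 1 \<le> n \<Longrightarrow> n < int N \<Longrightarrow> tau a b u n = z * u n" by blast
  define v where "v = vec (N - 1) (\<lambda>j. u (int j + 1))"
  have "v $ (nat n - 1) \<noteq> 0" "nat n - 1 < N - 1" using u(3-5) by (auto simp: v_def)
  then have "v \<noteq> 0\<^sub>v (N - 1)" by auto
  moreover have "jacobi_mat N a b *\<^sub>v v = z \<cdot>\<^sub>v v"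
  proof (rule eq_vecI)
    fix i assume "i < dim_vec (z \<cdot>\<^sub>v v)"
    then have i: "i < N - 1" by (simp add: v_def)
    show "(jacobi_mat N a b *\<^sub>v v) $ i = (z \<cdot>\<^sub>v v) $ i"
      using jacobi_mat_mult_vec[OF u(1,2) i, of a b] u(6)[of "int i + 1"] i by (simp add: v_def)
  qed (simp add: v_def)
  moreover have "v \<in> carrier_vec (N - 1)" by (simp add: v_def)
  ultimately show ?L unfolding eigenvalue_def eigenvector_def by auto
qed

text \<open>Shooting from the left: \<open>0\<close> and \<open>u 1\<close> determine the candidate,
  and \<open>u 1\<close> is nonzero because otherwise all interior values vanish. The condition left
  over is the one at \<open>N\<close>.\<close>

lemma eigenvalue_jacobi_mat_iff_orth_poly:
  assumes a: "\<And>n. a n < 0" and N: "N \<ge> 2"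
  shows "eigenvalue (jacobi_mat N a b) z \<longleftrightarrow> poly (orth_poly a b N) z = 0"
proof
  assume "eigenvalue (jacobi_mat N a b) z"
  then obtain u n where u: "u 0 = 0" "u (int N) = 0" "1 \<le> n" "n < int N" "u n \<noteq> 0"
    "\<And>n. 1 \<le> n \<Longrightarrow> n < int N \<Longrightarrow> tau a b u n = z * u n"
    unfolding eigenvalue_jacobi_mat_iff by blast
  note uniq = orth_poly_unique[of a u N b z, OF a u(1) u(6)]
  have "u n = u 1 * poly (orth_poly a b (nat n)) z" using uniq[of "nat n"] u(3,4) by simp
  then have "u 1 \<noteq> 0" using u(5) by auto
  then show "poly (orth_poly a b N) z = 0" using uniq[of N] u(2) by simp
next
  assume 0: "poly (orth_poly a b N) z = 0"
  \<comment> \<open>Through \<open>nat\<close> the sequence is zero at negative indices, where no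
    equation has to hold.\<close>
  define u where "u n = poly (orth_poly a b (nat n)) z" for n
  have "tau a b u n = z * u n" if n: "1 \<le> n" for n
  proof -
    define m where "m = nat n - 1"
    have m: "n = int m + 1" "nat n = Suc m" "nat (n + 1) = Suc (Suc m)" "nat (n - 1) = m"
      using n by (auto simp: m_def)
    have "a n \<noteq> 0" using a[of n] by simp
    then show ?thesis unfolding tau_def u_def m(2-4) by (simp add: m(1) field_simps)
  qed
  moreover have "u 0 = 0" "u (int N) = 0" "u 1 \<noteq> 0" using 0 by (auto simp: u_def)
  ultimately show "eigenvalue (jacobi_mat N a b) z"
    unfolding eigenvalue_jacobi_mat_iff using N by (intro exI[of _ u]) (auto intro!: exI[of _ 1])
qed

lemma num_eigenvalues_atMost:
  assumes a: "\<And>n. a n < 0" and N: "N \<ge> 2"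
  shows "num_eigenvalues {..z} (jacobi_mat N a b) =
    num_eigenvalues {..<z} (jacobi_mat N a b) + of_bool (eigenvalue (jacobi_mat N a b) z)"
proof -
  let ?E = "{s. eigenvalue (jacobi_mat N a b) s}"
  obtain n where n: "N = Suc n" using N by (cases N) auto
  \<comment> \<open>Positivity near minus infinity excludes the zero polynomial, so the spectrum is
    finite and \<open>card\<close> registers an added point.\<close>
  have "orth_poly a b N \<noteq> 0"
  proof
    assume "orth_poly a b N = 0"
    with eventually_orth_poly_pos[of a b n, OF a] have "\<forall>\<^sub>F x::real in at_bot. False" by (simp add: n)
    then show False by (simp add: trivial_limit_at_bot_linorder)
  qed
  then have "finite ?E"
    using eigenvalue_jacobi_mat_iff_orth_poly[of a N b, OF a N] by (simp add: poly_roots_finite)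
  then have fin: "finite {s \<in> {..<z}. eigenvalue (jacobi_mat N a b) s}" by (rule rev_finite_subset) auto
  show ?thesis
  proof (cases "eigenvalue (jacobi_mat N a b) z")
    case True
    then have "{s \<in> {..z}. eigenvalue (jacobi_mat N a b) s} =
      insert z {s \<in> {..<z}. eigenvalue (jacobi_mat N a b) s}" by auto
    then show ?thesis using True fin by (simp add: num_eigenvalues_def)
  next
    case False
    then have "{s \<in> {..z}. eigenvalue (jacobi_mat N a b) s} =
      {s \<in> {..<z}. eigenvalue (jacobi_mat N a b) s}" by (auto simp: less_le)
    then show ?thesis using False by (simp add: num_eigenvalues_def)
  qed
qed

text \<open>As \<open>a\<close> never vanishes, the recurrence runs in both directions and spreads
  two adjacent zeros over all integers.\<close>

lemma is_solution_no_double_zero: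
  assumes a: "\<And>n. a n < 0" and u: "is_solution a b z u"
  shows "u n \<noteq> 0 \<or> u (n + 1) \<noteq> 0"
proof (rule ccontr)
  assume n: "\<not> ?thesis"
  have t: "a k * u (k + 1) + a (k - 1) * u (k - 1) + b k * u k = z * u k" for k
    using u by (auto simp: is_solution_def tau_def)
  have "u k = 0 \<and> u (k + 1) = 0" for k
  proof (induction k rule: int_induct[where k = n])
    case base
    then show ?case using n by simp
  next
    case (step1 i)
    then show ?case using t[of "i + 1"] a[of "i + 1"] by (auto simp: algebra_simps)
  next
    case (step2 i)
    then show ?case using t[of i] a[of "i - 1"] by (auto simp: algebra_simps)
  qed
  then show False using u by (auto simp: is_solution_def)
qed

text \<open>The extra 1 is the charge for the zero at \<open>0\<close>. A zero at \<open>N\<close>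
  is not charged, since no step leaving it is summed; this matches the strict bound on the
  eigenvalues.\<close>

lemma flips_left:
  assumes a: "\<And>n. a n < 0" and N: "N \<ge> 2" and u: "is_solution a b z u" and u0: "u 0 = 0"
  shows "flips u N = 1 + int (num_eigenvalues {..<z} (jacobi_mat N a b))"
    and "u (int N) = 0 \<longleftrightarrow> eigenvalue (jacobi_mat N a b) z"
proof -
  obtain n where n: "N = Suc n" using N by (cases N) auto
  have u1: "u 1 \<noteq> 0" using is_solution_no_double_zero[of a b z u 0, OF a u] u0 by simp
  have uk: "u (int k) = u 1 * poly (orth_poly a b k) z" for k
    using orth_poly_unique[of a u k b z k, OF a u0] u by (auto simp: is_solution_def)
  have uk1: "u (int k + 1) = u 1 * poly (orth_poly a b (Suc k)) z" for k
    using uk[of "Suc k"] by (simp add: add.commute)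
  show "u (int N) = 0 \<longleftrightarrow> eigenvalue (jacobi_mat N a b) z"
    using uk[of N] u1 eigenvalue_jacobi_mat_iff_orth_poly[of a N b z, OF a N] by simp
  have "flips u N = (\<Sum>j<Suc n. flip (poly (orth_poly a b j) z) (poly (orth_poly a b (Suc j)) z))"
    unfolding flips_def n by (simp only: uk uk1 flip_mult[OF u1])
  also have "\<dots> = 1 + int (roots_below (orth_poly a b N) z)"
    unfolding sum.lessThan_Suc_shift n roots_below_orth_poly[of a b n z, OF a] by (simp add: flip_def)
  also have "roots_below (orth_poly a b N) z = num_eigenvalues {..<z} (jacobi_mat N a b)"
    using eigenvalue_jacobi_mat_iff_orth_poly[of a N b, OF a N]
    by (simp add: roots_below_def num_eigenvalues_def)
  finally show "flips u N = 1 + int (num_eigenvalues {..<z} (jacobi_mat N a b))" .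
qed

section \<open>Reflection and solutions vanishing at the right end\<close>

lemma tau_reflect:
  "tau (\<lambda>n. a (N - 1 - n)) (\<lambda>n. b (N - n)) (\<lambda>n. u (N - n)) n = tau a b u (N - n)"
proof -
  \<comment> \<open>The coefficient \<open>a n\<close> sits on the edge from \<open>n\<close> to
    \<open>n + 1\<close>, so its mirror index is \<open>N - 1 - n\<close>, while sites go to
    \<open>N - n\<close>.\<close>
  have "N - 1 - n = N - n - 1" "N - (n + 1) = N - n - 1" "N - 1 - (n - 1) = N - n"
    "N - (n - 1) = N - n + 1" by simp_all
  then show ?thesis by (simp only: tau_def)
qed

lemma eigenvalue_jacobi_mat_reflectD:
  assumes "eigenvalue (jacobi_mat N a b) z"
  shows "eigenvalue (jacobi_mat N (\<lambda>n. a (int N - 1 - n)) (\<lambda>n. b (int N - n))) z"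
proof -
  from assms obtain u n where u: "u 0 = 0" "u (int N) = 0" "1 \<le> n" "n < int N" "u n \<noteq> 0"
    "\<And>n. 1 \<le> n \<Longrightarrow> n < int N \<Longrightarrow> tau a b u n = z * u n"
    unfolding eigenvalue_jacobi_mat_iff by blast
  show ?thesis unfolding eigenvalue_jacobi_mat_iff
  proof (intro exI[of _ "\<lambda>n. u (int N - n)"] conjI exI[of _ "int N - n"] allI impI)
    fix k assume k: "1 \<le> k \<and> k < int N"
    show "tau (\<lambda>n. a (int N - 1 - n)) (\<lambda>n. b (int N - n)) (\<lambda>n. u (int N - n)) k = z * u (int N - k)"
      unfolding tau_reflect using u(6) k by simp
  qed (use u in simp_all)
qed

text \<open>Reflection is an involution, so the one-sided implication applied twice gives both
  directions.\<close>

lemma eigenvalue_jacobi_mat_reflect: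
  "eigenvalue (jacobi_mat N (\<lambda>n. a (int N - 1 - n)) (\<lambda>n. b (int N - n))) z
    \<longleftrightarrow> eigenvalue (jacobi_mat N a b) z"
  using eigenvalue_jacobi_mat_reflectD[of N a b z]
    eigenvalue_jacobi_mat_reflectD[of N "\<lambda>n. a (int N - 1 - n)" "\<lambda>n. b (int N - n)" z]
  by auto

text \<open>Reversing a step moves the charge for a zero to its other end. These corrections
  telescope, so only the two boundary points contribute.\<close>

lemma flips_reflect:
  "flips u N = flips (\<lambda>n. u (int N - n)) N + of_bool (u 0 = 0) - of_bool (u (int N) = 0)"
proof -
  have rev: "flips (\<lambda>n. u (int N - n)) N = (\<Sum>j<N. flip (u (int j + 1)) (u (int j)))"
    unfolding flips_def
    by (rule sum.reindex_bij_witness[of _ "\<lambda>j. N - 1 - j" "\<lambda>j. N - 1 - j"])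
      (auto simp: of_nat_diff algebra_simps)
  have swap: "flip x y = flip y x + (of_bool (x = 0) - of_bool (y = 0))" for x y
    by (simp add: flip_def mult.commute)
  have "flips u N = (\<Sum>j<N. flip (u (int j + 1)) (u (int j))
      + (of_bool (u (int j) = 0) - of_bool (u (int j + 1) = 0)))"
    unfolding flips_def by (rule sum.cong[OF refl swap])
  also have "\<dots> = flips (\<lambda>n. u (int N - n)) N
      + (\<Sum>j<N. of_bool (u (int j) = 0) - of_bool (u (int j + 1) = 0))"
    by (simp only: sum.distrib rev)
  also have "(\<Sum>j<N. of_bool (u (int j) = 0) - of_bool (u (int j + 1) = 0) :: int) =
      (\<Sum>j<N. of_bool (u (int j) = 0) - of_bool (u (int (Suc j)) = 0))"
    by (simp add: add.commute)
  also have "\<dots> = of_bool (u 0 = 0) - of_bool (u (int N) = 0)"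
    by (subst sum_lessThan_telescope') simp
  finally show ?thesis by simp
qed

text \<open>In the reflection formula the zero at \<open>N\<close> cancels the 1 from
  \<open>flips_left\<close>, and a zero at \<open>0\<close> occurs exactly when \<open>z\<close> is
  an eigenvalue, which closes the interval.\<close>

lemma flips_right:
  assumes a: "\<And>n. a n < 0" and N: "N \<ge> 2" and u: "is_solution a b z u" and uN: "u (int N) = 0"
  shows "flips u N = int (num_eigenvalues {..z} (jacobi_mat N a b))"
    and "u 0 = 0 \<longleftrightarrow> eigenvalue (jacobi_mat N a b) z"
proof -
  let ?a = "\<lambda>n. a (int N - 1 - n)" and ?b = "\<lambda>n. b (int N - n)" and ?v = "\<lambda>n. u (int N - n)"
  obtain k where "u k \<noteq> 0" using u by (auto simp: is_solution_def)
  then have "\<exists>n. ?v n \<noteq> 0" by (intro exI[of _ "int N - k"]) simp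
  then have v: "is_solution ?a ?b z ?v"
    using u by (auto simp: is_solution_def tau_reflect)
  have v0: "?v 0 = 0" using uN by simp
  note left = flips_left[of ?a N ?b z ?v, OF a N v v0]
  show eig: "u 0 = 0 \<longleftrightarrow> eigenvalue (jacobi_mat N a b) z"
    using left(2) by (simp add: eigenvalue_jacobi_mat_reflect)
  show "flips u N = int (num_eigenvalues {..z} (jacobi_mat N a b))"
    using left(1) flips_reflect[of u N] uN eig num_eigenvalues_atMost[of a N z b, OF a N]
    by (simp add: num_eigenvalues_def eigenvalue_jacobi_mat_reflect)
qed

section \<open>Weighted nodes of the Wronskian\<close>

text \<open>With \<open>r j = a j n * u j (n + 1) / u j n\<close>, taken to be infinite at a zero of \<open>u j\<close>, this is the
  indicator of \<open>r 1 > r 0\<close>.\<close>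

definition phase_less ::
  "(int \<Rightarrow> real) \<Rightarrow> (int \<Rightarrow> real) \<Rightarrow> (int \<Rightarrow> real) \<Rightarrow> (int \<Rightarrow> real) \<Rightarrow> int \<Rightarrow> int" where
  "phase_less a0 a1 u0 u1 n =
    of_bool (u0 n \<noteq> 0 \<and> (u1 n = 0 \<or> wronskian a0 a1 u0 u1 n * (u0 n * u1 n) > 0))"

lemma wronskian_Suc_eq:
  assumes "is_solution a0 b0 z0 u0" "is_solution a1 b1 z1 u1"
  shows "wronskian a0 a1 u0 u1 (n + 1) =
    u0 (n + 1) * ((z1 - b1 (n + 1)) * u1 (n + 1) - a1 n * u1 n)
      - u1 (n + 1) * ((z0 - b0 (n + 1)) * u0 (n + 1) - a0 n * u0 n)"
proof -
  have e: "a1 (n + 1) * u1 (n + 1 + 1) = (z1 - b1 (n + 1)) * u1 (n + 1) - a1 n * u1 n"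
    "a0 (n + 1) * u0 (n + 1 + 1) = (z0 - b0 (n + 1)) * u0 (n + 1) - a0 n * u0 n"
    using assms by (auto simp: is_solution_def tau_def algebra_simps dest!: spec[of _ "n + 1"])
  have "wronskian a0 a1 u0 u1 (n + 1) =
    u0 (n + 1) * (a1 (n + 1) * u1 (n + 1 + 1)) - u1 (n + 1) * (a0 (n + 1) * u0 (n + 1 + 1))"
    by (simp add: wronskian_def mult.assoc)
  then show ?thesis unfolding e .
qed

text \<open>If a value at \<open>n + 1\<close> vanishes, the weight is zero and at most one term of
  the Wronskian at \<open>n\<close> remains. Otherwise dividing by the values at
  \<open>n + 1\<close> leaves a comparison of two ratios.\<close>

lemma node_weight_eq:
  assumes a: "\<And>n. a0 n < 0" "\<And>n. a1 n < 0"
    and u: "is_solution a0 b0 z0 u0" "is_solution a1 b1 z1 u1"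
  shows "node_weight a0 a1 u0 u1 n =
    phase_less a0 a1 u0 u1 (n + 1) - phase_less a0 a1 u0 u1 n
      + flip (u1 n) (u1 (n + 1)) - flip (u0 n) (u0 (n + 1))"
proof -
  define s0 s1 t0 t1 where st: "s0 = u0 n" "s1 = u1 n" "t0 = u0 (n + 1)" "t1 = u1 (n + 1)"
  define w w' where ww: "w = wronskian a0 a1 u0 u1 n" "w' = wronskian a0 a1 u0 u1 (n + 1)"
  define \<alpha> \<beta> where \<alpha>\<beta>: "\<alpha> = - a0 n" "\<beta> = - a1 n"
  have pos: "\<alpha> > 0" "\<beta> > 0" using a by (simp_all add: \<alpha>\<beta>)
  have w: "w = \<alpha> * (s1 * t0) - \<beta> * (s0 * t1)"
    by (simp add: ww wronskian_def st \<alpha>\<beta> algebra_simps)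
  have w': "w' = t0 * ((z1 - b1 (n + 1)) * t1 + \<beta> * s1) - t1 * ((z0 - b0 (n + 1)) * t0 + \<alpha> * s0)"
    by (simp add: ww wronskian_Suc_eq[OF u] st \<alpha>\<beta>)
  have nz: "s0 \<noteq> 0 \<or> t0 \<noteq> 0" "s1 \<noteq> 0 \<or> t1 \<noteq> 0"
    using is_solution_no_double_zero[of a0 b0 z0 u0 n, OF a(1) u(1)]
      is_solution_no_double_zero[of a1 b1 z1 u1 n, OF a(2) u(2)] by (auto simp: st)
  have nw: "node_weight a0 a1 u0 u1 n =
    (if w' * t0 * t1 > 0 \<and> (w * w' < 0 \<or> (w = 0 \<and> w' \<noteq> 0)) then 1
     else if w * t0 * t1 > 0 \<and> (w * w' < 0 \<or> (w \<noteq> 0 \<and> w' = 0)) then - 1 else 0)"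
    by (simp only: node_weight_def Let_def ww st)
  have ph: "phase_less a0 a1 u0 u1 n = of_bool (s0 \<noteq> 0 \<and> (s1 = 0 \<or> w * (s0 * s1) > 0))"
    "phase_less a0 a1 u0 u1 (n + 1) = of_bool (t0 \<noteq> 0 \<and> (t1 = 0 \<or> w' * (t0 * t1) > 0))"
    by (simp_all add: phase_less_def ww st)
  have scale: "0 < c * y \<longleftrightarrow> 0 < y" if "0 < c" for c y :: real
    using that by (metis zero_less_mult_pos mult_pos_pos)
  consider "t0 = 0" "t1 = 0" | "t0 = 0" "t1 \<noteq> 0" | "t0 \<noteq> 0" "t1 = 0" | "t0 \<noteq> 0" "t1 \<noteq> 0"
    by blast
  then show ?thesis
  proof cases
    case 1
    then show ?thesis using nz unfolding ph nw flip_def st[symmetric] by (simp add: w)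
  next
    case 2
    \<comment> \<open>What remains to match is \<open>phase_less\<close> at \<open>n\<close> and the
      \<open>flip\<close> of \<open>u1\<close>.\<close>
    have "w * (s0 * s1) = (\<beta> * s0\<^sup>2) * - (s1 * t1)"
      using 2 by (simp add: w power2_eq_square)
    moreover have "\<beta> * s0\<^sup>2 > 0" using 2 nz pos by simp
    ultimately have "w * (s0 * s1) > 0 \<longleftrightarrow> s1 * t1 < 0"
      by (simp only: scale neg_0_less_iff_less)
    then show ?thesis using 2 nz unfolding ph nw flip_def st[symmetric]
      by (cases "s1 = 0") simp_all
  next
    case 3
    \<comment> \<open>Here \<open>phase_less\<close> at \<open>n + 1\<close> is 1, and it must equal
      \<open>phase_less\<close> at \<open>n\<close> plus the \<open>flip\<close> of
      \<open>u0\<close>.\<close>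
    have "w * (s0 * s1) = (\<alpha> * s1\<^sup>2) * (s0 * t0)"
      using 3 by (simp add: w power2_eq_square)
    moreover have "\<alpha> * s1\<^sup>2 > 0" using 3 nz pos by simp
    ultimately have "w * (s0 * s1) > 0 \<longleftrightarrow> s0 * t0 > 0"
      by (simp only: scale)
    moreover have "s0 * t0 = 0 \<longleftrightarrow> s0 = 0" using 3 by simp
    ultimately show ?thesis using 3 nz unfolding ph nw flip_def st[symmetric]
      by (cases "s0 * t0" "0::real" rule: linorder_cases) auto
  next
    case 4
    \<comment> \<open>The signs of \<open>x\<close> and \<open>y\<close> are those of the Wronskians
      at \<open>n\<close> and \<open>n + 1\<close> times \<open>P\<close>. In them the weight is a
      difference of two indicators, and \<open>y > 0\<close> is already the phase comparison at
      \<open>n + 1\<close>.\<close>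
    define q0 q1 where q: "q0 = s0 / t0" "q1 = s1 / t1"
    have s: "s0 = q0 * t0" "s1 = q1 * t1" using 4 by (simp_all add: q)
    define P where "P = t0 * t1"
    define x where "x = \<alpha> * q1 - \<beta> * q0"
    define y where "y = w' * P"
    have P: "P \<noteq> 0" using 4 by (simp add: P_def)
    have wx: "w = x * P" by (simp add: w s x_def P_def algebra_simps)
    have P2: "P * P > 0" using P by (metis not_real_square_gt_zero)
    have e1: "w * t0 * t1 = (P * P) * x" "w' * t0 * t1 = y" "w * w' = x * y"
      by (simp_all add: wx y_def P_def)
    have e2: "w = 0 \<longleftrightarrow> x = 0" "w' = 0 \<longleftrightarrow> y = 0" using P by (simp_all add: wx y_def)
    have "node_weight a0 a1 u0 u1 n = of_bool (y > 0) - of_bool (x > 0)"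
      unfolding nw e1 e2 scale[OF P2]
      by (cases x "0::real" rule: linorder_cases; cases y "0::real" rule: linorder_cases)
        (simp_all add: mult_less_0_iff)
    moreover have "w * (s0 * s1) = (P * P) * (x * (q0 * q1))"
      by (simp add: wx s P_def)
    then have "w * (s0 * s1) > 0 \<longleftrightarrow> x * (q0 * q1) > 0"
      by (simp only: scale[OF P2])
    moreover have "s0 = 0 \<longleftrightarrow> q0 = 0" "s1 = 0 \<longleftrightarrow> q1 = 0" using 4 by (simp_all add: s)
    moreover have "flip s0 t0 = of_bool (q0 \<le> 0)" "flip s1 t1 = of_bool (q1 \<le> 0)"
      using 4 by (auto simp: flip_def s mult_less_0_iff zero_less_mult_iff)
    \<comment> \<open>For \<open>q0\<close> and \<open>q1\<close> of equal strict sign,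
      \<open>x > 0\<close> is the phase comparison itself. Otherwise their signs decide the sign of
      \<open>x\<close>, and the two flips make up the difference.\<close>
    moreover have "of_bool (x > 0) = of_bool (q0 \<noteq> 0 \<and> (q1 = 0 \<or> x * (q0 * q1) > 0))
        - of_bool (q1 \<le> 0) + (of_bool (q0 \<le> 0) :: int)"
    proof -
      consider "q0 > 0" | "q0 = 0" | "q0 < 0" by linarith
      then show ?thesis
      proof cases
        case 1
        then have "q1 \<le> 0 \<Longrightarrow> x < 0"
          using pos mult_pos_pos[of \<beta> q0] mult_nonneg_nonpos[of \<alpha> q1] unfolding x_def by linarith
        then show ?thesis using 1 by (cases q1 "0::real" rule: linorder_cases)
          (auto simp: zero_less_mult_iff mult_less_0_iff)
      next
        case 2
        then show ?thesis using pos by (auto simp: x_def zero_less_mult_iff)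
      next
        case 3
        then have "q1 \<ge> 0 \<Longrightarrow> x > 0"
          using pos mult_pos_neg[of \<beta> q0] mult_nonneg_nonneg[of \<alpha> q1] unfolding x_def by linarith
        then show ?thesis using 3 by (cases q1 "0::real" rule: linorder_cases)
          (auto simp: zero_less_mult_iff mult_less_0_iff)
      qed
    qed
    ultimately show ?thesis using 4 unfolding ph st[symmetric] P_def[symmetric] y_def[symmetric] by simp
  qed
qed

lemma nodes_cc_eq:
  assumes a: "\<And>n. a0 n < 0" "\<And>n. a1 n < 0"
    and u: "is_solution a0 b0 z0 u0" "is_solution a1 b1 z1 u1"
  shows "nodes_cc a0 a1 u0 u1 0 (int m) =
    phase_less a0 a1 u0 u1 (int m) - phase_less a0 a1 u0 u1 0 + flips u1 m - flips u0 m"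
proof (induction m)
  case (Suc m)
  have "{0..int (Suc m) - 1} = insert (int m) {0..int m - 1}" by auto
  then show ?case using Suc.IH node_weight_eq[of a0 a1 b0 z0 u0 b1 z1 u1 "int m", OF a u]
    by (simp add: nodes_cc_def flips_def add.commute)
qed (simp add: nodes_cc_def flips_def)

theorem theorem1p1:
  fixes N :: nat and a0 b0 a1 b1 :: "int \<Rightarrow> real" and lam0 lam1 :: real
    and u0m u0p u1m u1p :: "int \<Rightarrow> real"
  assumes "N \<ge> 2"
    and "\<forall>n. a0 n < 0" and "\<forall>n. a1 n < 0"
    and "is_solution a0 b0 lam0 u0m" and "u0m 0 = 0"
    and "is_solution a0 b0 lam0 u0p" and "u0p (int N) = 0"
    and "is_solution a1 b1 lam1 u1m" and "u1m 0 = 0"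
    and "is_solution a1 b1 lam1 u1p" and "u1p (int N) = 0"
  shows "int (num_eigenvalues {..<lam1} (jacobi_mat N a1 b1)) - int (num_eigenvalues {..lam0} (jacobi_mat N a0 b0))
          = nodes_oc a0 a1 u0p u1m 0 (int N) \<and>
         nodes_oc a0 a1 u0p u1m 0 (int N)
          = nodes_oc a0 a1 u0m u1p 0 (int N) \<and>
         int (num_eigenvalues {..<lam1} (jacobi_mat N a1 b1)) - int (num_eigenvalues {..<lam0} (jacobi_mat N a0 b0))
          = nodes_cc a0 a1 u0p u1m 0 (int N) \<and>
         nodes_cc a0 a1 u0p u1m 0 (int N)
          = nodes_oo a0 a1 u0m u1p 0 (int N) \<and>
         int (num_eigenvalues {..lam1} (jacobi_mat N a1 b1)) - int (num_eigenvalues {..lam0} (jacobi_mat N a0 b0))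
          = nodes_oo a0 a1 u0p u1m 0 (int N) \<and>
         nodes_oo a0 a1 u0p u1m 0 (int N)
          = nodes_cc a0 a1 u0m u1p 0 (int N) \<and>
         int (num_eigenvalues {..lam1} (jacobi_mat N a1 b1)) - int (num_eigenvalues {..<lam0} (jacobi_mat N a0 b0))
          = nodes_co a0 a1 u0p u1m 0 (int N) \<and>
         nodes_co a0 a1 u0p u1m 0 (int N)
          = nodes_co a0 a1 u0m u1p 0 (int N)"
proof -
  have a: "\<And>n. a0 n < 0" "\<And>n. a1 n < 0" using assms(2,3) by auto
  let ?J0 = "jacobi_mat N a0 b0" and ?J1 = "jacobi_mat N a1 b1"
  note L0 = flips_left[of a0 N b0 lam0 u0m, OF a(1) assms(1,4,5)]
  note R0 = flips_right[of a0 N b0 lam0 u0p, OF a(1) assms(1,6,7)]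
  note L1 = flips_left[of a1 N b1 lam1 u1m, OF a(2) assms(1,8,9)]
  note R1 = flips_right[of a1 N b1 lam1 u1p, OF a(2) assms(1,10,11)]
  note le0 = num_eigenvalues_atMost[of a0 N lam0 b0, OF a(1) assms(1)]
  note le1 = num_eigenvalues_atMost[of a1 N lam1 b1, OF a(2) assms(1)]
  have nz: "u0m 1 \<noteq> 0" "u1m 1 \<noteq> 0" "u0p (int N + 1) \<noteq> 0" "u1p (int N + 1) \<noteq> 0"
    using is_solution_no_double_zero[of a0 b0 lam0 u0m 0, OF a(1) assms(4)]
      is_solution_no_double_zero[of a1 b1 lam1 u1m 0, OF a(2) assms(8)]
      is_solution_no_double_zero[of a0 b0 lam0 u0p "int N", OF a(1) assms(6)]
      is_solution_no_double_zero[of a1 b1 lam1 u1p "int N", OF a(2) assms(10)] assms by auto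
  have ane: "a0 n \<noteq> 0" "a1 n \<noteq> 0" for n using a[of n] by auto
  \<comment> \<open>Where one solution vanishes, the Wronskian is a single product whose other
    factors are nonzero except for the second solution's value at that end.\<close>
  have zpm: "wronskian_zero a0 a1 u0p u1m 0 = of_bool (eigenvalue ?J0 lam0)"
    "wronskian_zero a0 a1 u0p u1m (int N) = of_bool (eigenvalue ?J1 lam1)"
    and zmp: "wronskian_zero a0 a1 u0m u1p 0 = of_bool (eigenvalue ?J1 lam1)"
    "wronskian_zero a0 a1 u0m u1p (int N) = of_bool (eigenvalue ?J0 lam0)"
    using nz ane assms(5,7,9,11) L0(2) R0(2) L1(2) R1(2)
    by (simp_all add: wronskian_zero_def wronskian_def)
  \<comment> \<open>At \<open>N\<close> the term \<open>phase_less\<close> is 0; at \<open>0\<close>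
    it is 1 unless \<open>lam0\<close> is an eigenvalue. This cancels the 1 in the flips of
    \<open>u1m\<close> and opens the count for \<open>lam0\<close>.\<close>
  have pm: "nodes_cc a0 a1 u0p u1m 0 (int N) =
    int (num_eigenvalues {..<lam1} ?J1) - int (num_eigenvalues {..<lam0} ?J0)"
    unfolding nodes_cc_eq[of a0 a1 b0 lam0 u0p b1 lam1 u1m, OF a assms(6,8)]
    using assms(7,9) R0 L1(1) le0 by (simp add: phase_less_def)
  \<comment> \<open>Now \<open>phase_less\<close> is 0 at \<open>0\<close> and depends on
    \<open>lam0\<close> at \<open>N\<close>: it cancels the 1 in the flips of \<open>u0m\<close> and
    closes the count for \<open>lam0\<close>.\<close>
  have mp: "nodes_cc a0 a1 u0m u1p 0 (int N) =
    int (num_eigenvalues {..lam1} ?J1) - int (num_eigenvalues {..lam0} ?J0)"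
    unfolding nodes_cc_eq[of a0 a1 b0 lam0 u0m b1 lam1 u1p, OF a assms(4,10)]
    using assms(5,11) L0 R1(1) le0 by (simp add: phase_less_def)
  \<comment> \<open>Each correction for an open end is an eigenvalue indicator, the same amount by
    which closing a half-line changes a count.\<close>
  show ?thesis
    unfolding nodes_oc_def nodes_co_def nodes_oo_def pm mp zpm zmp le0 le1 by simp
qed

end
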